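(* Let $(\Omega,\mathcal{F},\mathbb{P})$ be a finite probability space (i.e. $\Omega$ is a finite set) and $\alpha\in(0,1)$. Let $S=(S_0,S_T)$ be a traded asset, and assume $\rho_{\mathscr{A}_\alpha,S}$ is finitely valued. The following conditions are equivalent: (a) $\rho_{\mathscr{A}_\alpha,S}$ is continuous on $\mathscr{X}$; (b) $\mathbb{P}[A]\le\alpha-\mathbb{P}[S_T=0]$ for every measurable set $A\subset\{S_T>0\}$ with $\mathbb{P}[A]\le\alpha$.
   Context: $\mathscr{X}$ is the Banach space of bounded $\mathcal{F}$-measurable functions $X:\Omega\to\mathbb{R}$ with the supremum norm and the pointwise order (functions are not identified almost surely); $\mathscr{X}_+=\{X\in\mathscr{X}: X\ge 0\}$. For $\alpha\in(0,1)$ and $X\in\mathscr{X}$, $\mathrm{VaR}_\alpha(X)=\inf\{m\in\mathbb{R}:\mathbb{P}[X+m<0]\le\alpha\}$, and $\mathscr{A}_\alpha=\{X\in\mathscr{X}:\mathrm{VaR}_\alpha(X)\le 0\}=\{X\in\mathscr{X}:\mathbb{P}[X<0]\le\alpha\}$. A traded asset is a pair $S=(S_0,S_T)$ with $S_0\in\mathbb{R}$, $S_0>0$, and $S_T\in\mathscr{X}_+$, $S_T\ne 0$. For $\mathscr{A}\subset\mathscr{X}$, $\rho_{\mathscr{A},S}:\mathscr{X}\to\mathbb{R}\cup\{-\infty,\infty\}$ is $\rho_{\mathscr{A},S}(X)=\inf\{m\in\mathbb{R}: X+\frac{m}{S_0}S_T\in\mathscr{A}\}$ (with $\inf\emptyset=\infty$).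 It is finitely valued if $\rho_{\mathscr{A},S}(X)\in\mathbb{R}$ for every $X\in\mathscr{X}$. *)

theory Defs
  imports "HOL-Probability.Probability"
begin

text \<open>
  Positions are functions on \<open>space M\<close>; taking them extensional makes equality in the set below
  equality at every point of \<open>space M\<close> (and not almost sure equality).
\<close>

definition positions :: "'a measure \<Rightarrow> ('a \<Rightarrow> real) set" where
  "positions M = {X \<in> borel_measurable M. X \<in> extensional (space M) \<and> bounded (X ` space M)}"

definition sup_norm :: "'a measure \<Rightarrow> ('a \<Rightarrow> real) \<Rightarrow> real" where
  "sup_norm M X = (SUP \<omega>\<in>space M. \<bar>X \<omega>\<bar>)"

text \<open>
  The value \<open>0\<close> off \<open>positions M\<close> is irrelevant for the topology; it is there because the locale
  \<open>Metric_space\<close> requires nonnegativity and symmetry for all arguments.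
\<close>

definition sup_dist :: "'a measure \<Rightarrow> ('a \<Rightarrow> real) \<Rightarrow> ('a \<Rightarrow> real) \<Rightarrow> real" where
  "sup_dist M X Y =
     (if X \<in> positions M \<and> Y \<in> positions M then sup_norm M (\<lambda>\<omega>. X \<omega> - Y \<omega>) else 0)"

definition positions_topology :: "'a measure \<Rightarrow> ('a \<Rightarrow> real) topology" where
  "positions_topology M = Metric_space.mtopology (positions M) (sup_dist M)"

definition VaR :: "'a measure \<Rightarrow> real \<Rightarrow> ('a \<Rightarrow> real) \<Rightarrow> ereal" where
  "VaR M \<alpha> X = Inf (ereal ` {m. measure M {\<omega> \<in> space M. X \<omega> + m < 0} \<le> \<alpha>})"

definition VaR_acceptance :: "'a measure \<Rightarrow> real \<Rightarrow> ('a \<Rightarrow> real) set" where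
  "VaR_acceptance M \<alpha> = {X \<in> positions M. VaR M \<alpha> X \<le> 0}"

definition traded_asset :: "'a measure \<Rightarrow> real \<times> ('a \<Rightarrow> real) \<Rightarrow> bool" where
  "traded_asset M S \<longleftrightarrow> fst S > 0 \<and> snd S \<in> positions M \<and>
     (\<forall>\<omega>\<in>space M. snd S \<omega> \<ge> 0) \<and> (\<exists>\<omega>\<in>space M. snd S \<omega> \<noteq> 0)"

text \<open>The infimum is taken in the extended reals, so that \<open>Inf {} = \<infinity>\<close>.\<close>

definition risk_measure ::
  "'a measure \<Rightarrow> ('a \<Rightarrow> real) set \<Rightarrow> real \<times> ('a \<Rightarrow> real) \<Rightarrow> ('a \<Rightarrow> real) \<Rightarrow> ereal" where
  "risk_measure M A S X =
     Inf (ereal ` {m. (\<lambda>\<omega>\<in>space M. X \<omega> + m / fst S * snd S \<omega>) \<in> A})"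

definition finitely_valued :: "'a measure \<Rightarrow> (('a \<Rightarrow> real) \<Rightarrow> ereal) \<Rightarrow> bool" where
  "finitely_valued M \<rho> \<longleftrightarrow> (\<forall>X\<in>positions M. \<rho> X \<in> range ereal)"

lemma abs_le_sup_norm:
  assumes "bounded (X ` space M)" "\<omega> \<in> space M"
  shows "\<bar>X \<omega>\<bar> \<le> sup_norm M X"
proof -
  from assms(1) obtain b where "\<And>y. y \<in> X ` space M \<Longrightarrow> \<bar>y\<bar> \<le> b"
    unfolding bounded_iff by auto
  then have "bdd_above ((\<lambda>\<omega>. \<bar>X \<omega>\<bar>) ` space M)"
    by (intro bdd_aboveI[of _ b]) auto
  then show ?thesis
    unfolding sup_norm_def using assms(2) by (rule cSUP_upper[rotated])
qed

lemma Metric_space_positions: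
  assumes "prob_space M"
  shows "Metric_space (positions M) (sup_dist M)"
proof -
  obtain \<omega>0 where \<omega>0: "\<omega>0 \<in> space M"
    using prob_space.not_empty[OF assms] by blast
  have le: "\<bar>X \<omega> - Y \<omega>\<bar> \<le> sup_dist M X Y"
    if "X \<in> positions M" "Y \<in> positions M" "\<omega> \<in> space M" for X Y \<omega>
  proof -
    have "bounded ((\<lambda>\<omega>. X \<omega> - Y \<omega>) ` space M)"
      using that by (auto simp: positions_def intro: bounded_minus_comp)
    from abs_le_sup_norm[OF this \<open>\<omega> \<in> space M\<close>] show ?thesis
      using that by (simp add: sup_dist_def)
  qed
  have least: "sup_dist M X Y \<le> c"
    if "X \<in> positions M" "Y \<in> positions M" "\<And>\<omega>. \<omega> \<in> space M \<Longrightarrow> \<bar>X \<omega> - Y \<omega>\<bar> \<le> c" for X Y c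
  proof -
    have "(SUP \<omega>\<in>space M. \<bar>X \<omega> - Y \<omega>\<bar>) \<le> c"
      using \<omega>0 that(3) by (intro cSUP_least) auto
    then show ?thesis
      using that(1,2) by (simp add: sup_dist_def sup_norm_def)
  qed
  show ?thesis
  proof
    show nonneg: "0 \<le> sup_dist M X Y" for X Y
    proof (cases "X \<in> positions M \<and> Y \<in> positions M")
      case True
      then show ?thesis using le[of X Y \<omega>0] \<omega>0 by linarith
    next
      case False
      then show ?thesis unfolding sup_dist_def by auto
    qed
    show "sup_dist M X Y = sup_dist M Y X" for X Y
      by (simp add: sup_dist_def sup_norm_def abs_minus_commute)
    show "sup_dist M X Y = 0 \<longleftrightarrow> X = Y" if "X \<in> positions M" "Y \<in> positions M" for X Y
    proof
      assume 0: "sup_dist M X Y = 0"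
      show "X = Y"
      proof (rule extensionalityI[of _ "space M"])
        show "X \<in> extensional (space M)" "Y \<in> extensional (space M)"
          using that by (auto simp: positions_def)
        show "X \<omega> = Y \<omega>" if "\<omega> \<in> space M" for \<omega>
          using le[OF \<open>X \<in> positions M\<close> \<open>Y \<in> positions M\<close> that] 0 by simp
      qed
    next
      assume "X = Y"
      then have "sup_dist M X Y \<le> 0" using that by (intro least) auto
      then show "sup_dist M X Y = 0" using nonneg[of X Y] by linarith
    qed
    show "sup_dist M X Z \<le> sup_dist M X Y + sup_dist M Y Z"
      if "X \<in> positions M" "Y \<in> positions M" "Z \<in> positions M" for X Y Z
    proof (rule least)
      show "\<bar>X \<omega> - Z \<omega>\<bar> \<le> sup_dist M X Y + sup_dist M Y Z" if "\<omega> \<in> space M" for \<omega>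
        using le[of X Y \<omega>] le[of Y Z \<omega>] that
          \<open>X \<in> positions M\<close> \<open>Y \<in> positions M\<close> \<open>Z \<in> positions M\<close> by linarith
    qed (use that in auto)
  qed
qed

lemma VaR_acceptance_eq:
  assumes "prob_space M"
  shows "VaR_acceptance M \<alpha> =
    {X \<in> positions M. measure M {\<omega> \<in> space M. X \<omega> < 0} \<le> \<alpha>}"
proof -
  interpret prob_space M by (rule assms)
  have "VaR M \<alpha> X \<le> 0 \<longleftrightarrow> measure M {\<omega> \<in> space M. X \<omega> < 0} \<le> \<alpha>"
    if X: "X \<in> positions M" for X
  proof
    have [measurable]: "X \<in> borel_measurable M"
      using X by (simp add: positions_def)
    assume VaR: "VaR M \<alpha> X \<le> 0"
    let ?B = "\<lambda>n::nat. {\<omega> \<in> space M. X \<omega> + 1 / real (Suc n) < 0}"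
    have "measure M (?B n) \<le> \<alpha>" for n
    proof -
      have "VaR M \<alpha> X < ereal (1 / real (Suc n))"
        using VaR by (rule le_less_trans) simp
      then obtain m where m: "measure M {\<omega> \<in> space M. X \<omega> + m < 0} \<le> \<alpha>" "m < 1 / real (Suc n)"
        unfolding VaR_def Inf_less_iff by auto
      have "measure M (?B n) \<le> measure M {\<omega> \<in> space M. X \<omega> + m < 0}"
        using m(2) by (intro finite_measure_mono) auto
      then show ?thesis using m(1) by linarith
    qed
    moreover have "(\<lambda>n. measure M (?B n)) \<longlonglongrightarrow> measure M (\<Union>n. ?B n)"
    proof (rule finite_Lim_measure_incseq)
      show "range ?B \<subseteq> sets M" by auto
      show "incseq ?B"
      proof (rule incseq_SucI, safe)
        fix n \<omega> assume "X \<omega> + 1 / real (Suc n) < 0"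
        moreover have "1 / real (Suc (Suc n)) \<le> 1 / real (Suc n)"
          by (simp add: field_simps)
        ultimately show "X \<omega> + 1 / real (Suc (Suc n)) < 0" by linarith
      qed
    qed
    ultimately have "measure M (\<Union>n. ?B n) \<le> \<alpha>"
      by (intro LIMSEQ_le_const2) auto
    moreover have "(\<Union>n. ?B n) = {\<omega> \<in> space M. X \<omega> < 0}"
    proof safe
      fix n \<omega> assume "X \<omega> + 1 / real (Suc n) < 0"
      moreover have "0 < 1 / real (Suc n)" by simp
      ultimately show "X \<omega> < 0" by linarith
    next
      fix \<omega> assume "\<omega> \<in> space M" "X \<omega> < 0"
      then obtain n where "1 / real (Suc n) < - X \<omega>"
        using reals_Archimedean[of "- X \<omega>"] by (auto simp: inverse_eq_divide)
      then show "\<omega> \<in> (\<Union>n. ?B n)" using \<open>\<omega> \<in> space M\<close> by (auto intro!: exI[of _ n])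
    qed
    ultimately show "measure M {\<omega> \<in> space M. X \<omega> < 0} \<le> \<alpha>" by simp
  next
    assume "measure M {\<omega> \<in> space M. X \<omega> < 0} \<le> \<alpha>"
    then show "VaR M \<alpha> X \<le> 0"
      unfolding VaR_def by (intro Inf_lower image_eqI[of _ _ 0]) (auto simp: zero_ereal_def)
  qed
  then show ?thesis
    by (auto simp: VaR_acceptance_def)
qed

end

theory Submission
  imports Defs
begin

text \<open>
  Write \<open>Z = {S\<^sub>T = 0}\<close>. Adding units of the asset repairs a shortfall only off \<open>Z\<close>, so the shortfall
  on \<open>Z\<close> is what can make the risk measure jump. Under (b) the event \<open>Z\<close> never decides
  acceptability; the risk measure then only sees \<open>{S\<^sub>T > 0}\<close>, where \<open>S\<^sub>T\<close> is bounded away from \<open>0\<close>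
  by finiteness, and is therefore Lipschitz. If (b) fails for \<open>A\<close>, then the position that is short one
  unit of the asset (normalised to price one) on \<open>A\<close> and \<open>0\<close> elsewhere has risk at most \<open>0\<close>, while
  any loss on \<open>Z\<close>, however small, raises the risk to at least \<open>1\<close>.
\<close>

text \<open>A one-sided estimate suffices because it is assumed for both orders of the pair:
  exchanging \<open>x\<close> and \<open>y\<close> bounds the absolute difference. As
  \<open>f\<close> takes only finite values on the space, continuity is checked for the real
  function \<open>h\<close> and transferred along \<open>ereal\<close>.\<close>

lemma (in Metric_space) continuous_map_ereal_Lipschitz:
  assumes f: "\<And>x. x \<in> M \<Longrightarrow> f x = ereal (h x)"
    and L: "0 < L" "\<And>x y. x \<in> M \<Longrightarrow> y \<in> M \<Longrightarrow> h y \<le> h x + L * d x y"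
  shows "continuous_map mtopology euclidean f"
proof -
  have "openin mtopology {x \<in> M. h x \<in> U}" if U: "open U" for U
    unfolding openin_mtopology
  proof (intro conjI allI impI)
    fix x assume x: "x \<in> {x \<in> M. h x \<in> U}"
    then obtain e where e: "0 < e" "\<And>y. dist y (h x) < e \<Longrightarrow> y \<in> U"
      using U unfolding open_dist by blast
    have "h y \<in> U" if y: "y \<in> M" "d x y < e / L" for y
    proof (rule e(2))
      have "L * d x y < e" using y(2) L(1) by (simp add: field_simps)
      then show "dist (h y) (h x) < e"
        using L(2)[of x y] L(2)[of y x] x y(1) by (simp add: dist_real_def commute)
    qed
    then have "mball x (e / L) \<subseteq> {x \<in> M. h x \<in> U}" by auto
    then show "\<exists>r>0. mball x r \<subseteq> {x \<in> M. h x \<in> U}"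
      using e(1) L(1) by (intro exI[of _ "e / L"]) simp
  qed auto
  then have "continuous_map mtopology euclideanreal h"
    by (simp add: continuous_map_def)
  moreover have "continuous_map euclideanreal euclidean ereal"
    by (simp add: continuous_on_ereal)
  ultimately have "continuous_map mtopology euclidean (ereal \<circ> h)"
    by (rule continuous_map_compose)
  then show ?thesis
    by (rule continuous_map_eq) (simp add: f)
qed

lemma restrict_in_positions:
  assumes "finite (space M)" "f \<in> borel_measurable M"
  shows "restrict f (space M) \<in> positions M"
proof -
  have "restrict f (space M) \<in> borel_measurable M"
    using assms(2) by (subst measurable_cong[where g = f]) auto
  then show ?thesis
    using assms(1) by (simp add: positions_def finite_imp_bounded)
qed

lemma abs_diff_le_sup_dist:
  assumes "X \<in> positions M" "Y \<in> positions M" "\<omega> \<in> space M"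
  shows "\<bar>X \<omega> - Y \<omega>\<bar> \<le> sup_dist M X Y"
proof -
  have "bounded ((\<lambda>\<omega>. X \<omega> - Y \<omega>) ` space M)"
    using assms by (auto simp: positions_def intro: bounded_minus_comp)
  from abs_le_sup_norm[OF this assms(3)] show ?thesis
    using assms by (simp add: sup_dist_def)
qed

lemma sup_dist_le:
  assumes "X \<in> positions M" "Y \<in> positions M" "space M \<noteq> {}"
    and "\<And>\<omega>. \<omega> \<in> space M \<Longrightarrow> \<bar>X \<omega> - Y \<omega>\<bar> \<le> c"
  shows "sup_dist M X Y \<le> c"
proof -
  have "(SUP \<omega>\<in>space M. \<bar>X \<omega> - Y \<omega>\<bar>) \<le> c"
    using assms(3,4) by (intro cSUP_least) auto
  then show ?thesis
    using assms(1,2) by (simp add: sup_dist_def sup_norm_def)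
qed

text \<open>This trades the value at risk for a bound on the shortfall probability. Finiteness of
  the space makes every shifted position bounded, so measurability is all that remains of membership
  in \<open>positions M\<close>.\<close>

lemma risk_measure_VaR_acceptance:
  assumes "prob_space M" "finite (space M)"
    and "X \<in> borel_measurable M" "snd S \<in> borel_measurable M"
  shows "risk_measure M (VaR_acceptance M \<alpha>) S X =
    Inf (ereal ` {m. measure M {\<omega> \<in> space M. X \<omega> + m * (snd S \<omega> / fst S) < 0} \<le> \<alpha>})"
proof -
  have "(\<lambda>\<omega>\<in>space M. X \<omega> + m / fst S * snd S \<omega>) \<in> VaR_acceptance M \<alpha> \<longleftrightarrow>
      measure M {\<omega> \<in> space M. X \<omega> + m * (snd S \<omega> / fst S) < 0} \<le> \<alpha>" for m
  proof -
    have "{\<omega> \<in> space M. (\<lambda>\<omega>\<in>space M. X \<omega> + m / fst S * snd S \<omega>) \<omega> < 0} =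
        {\<omega> \<in> space M. X \<omega> + m * (snd S \<omega> / fst S) < 0}"
      by auto
    moreover have "(\<lambda>\<omega>\<in>space M. X \<omega> + m / fst S * snd S \<omega>) \<in> positions M"
      using assms(2-4) by (intro restrict_in_positions borel_measurable_add borel_measurable_times) auto
    ultimately show ?thesis
      by (simp add: VaR_acceptance_eq[OF assms(1)])
  qed
  then show ?thesis
    by (simp add: risk_measure_def)
qed

theorem proposition4p13:
  fixes M :: "'a measure" and \<alpha> :: real and S :: "real \<times> ('a \<Rightarrow> real)"
  assumes "prob_space M" and "finite (space M)"
    and "0 < \<alpha>" and "\<alpha> < 1"
    and "traded_asset M S"
    and "finitely_valued M (risk_measure M (VaR_acceptance M \<alpha>) S)"
  shows "continuous_map (positions_topology M) euclidean (risk_measure M (VaR_acceptance M \<alpha>) S)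
    \<longleftrightarrow>
    (\<forall>A\<in>sets M. A \<subseteq> {\<omega> \<in> space M. snd S \<omega> > 0} \<and> measure M A \<le> \<alpha> \<longrightarrow>
       measure M A \<le> \<alpha> - measure M {\<omega> \<in> space M. snd S \<omega> = 0})"
proof -
  interpret prob_space M by (rule assms(1))
  interpret P: Metric_space "positions M" "sup_dist M"
    by (rule Metric_space_positions[OF assms(1)])
  define \<rho> where "\<rho> = risk_measure M (VaR_acceptance M \<alpha>) S"
  define g where "g = (\<lambda>\<omega>. snd S \<omega> / fst S)"
  define U where "U = {\<omega> \<in> space M. snd S \<omega> > 0}"
  define Z where "Z = {\<omega> \<in> space M. snd S \<omega> = 0}"
  have S0: "fst S > 0" and S_nonneg: "\<And>\<omega>. \<omega> \<in> space M \<Longrightarrow> snd S \<omega> \<ge> 0"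
    and S_nonzero: "\<exists>\<omega>\<in>space M. snd S \<omega> \<noteq> 0"
    and [measurable]: "snd S \<in> borel_measurable M"
    using assms(5) by (auto simp: traded_asset_def positions_def)
  have [measurable]: "g \<in> borel_measurable M" "U \<in> sets M" "Z \<in> sets M"
    unfolding g_def U_def Z_def by measurable
  have gU: "g \<omega> > 0" if "\<omega> \<in> U" for \<omega>
    using that S0 by (simp add: U_def g_def)
  have gZ: "g \<omega> = 0" if "\<omega> \<in> Z" for \<omega>
    using that by (simp add: Z_def g_def)
  have UZ: "U \<union> Z = space M" "U \<inter> Z = {}"
    using S_nonneg by (force simp: U_def Z_def)+
  have meas: "X \<in> borel_measurable M" if "X \<in> positions M" for X
    using that by (simp add: positions_def)
  \<comment> \<open>The shortfall that remains after capital \<open>m\<close> is invested in the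
    asset, \<open>g\<close> being the payoff per unit of capital.\<close>
  define F where "F = (\<lambda>X m. {\<omega> \<in> space M. X \<omega> + m * g \<omega> < 0})"
  have F_sets[measurable]: "F X m \<in> sets M" if "X \<in> positions M" for X m
    using meas[OF that] unfolding F_def by measurable
  have \<rho>: "\<rho> X = Inf (ereal ` {m. measure M (F X m) \<le> \<alpha>})" if "X \<in> positions M" for X
    using risk_measure_VaR_acceptance[OF assms(1,2) meas[OF that], of S \<alpha>]
    by (simp add: \<rho>_def g_def F_def)

  have "continuous_map (positions_topology M) euclidean \<rho>"
    if b: "\<And>A. A \<in> sets M \<Longrightarrow> A \<subseteq> U \<Longrightarrow> measure M A \<le> \<alpha> \<Longrightarrow> measure M A \<le> \<alpha> - measure M Z"
    unfolding positions_topology_def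
  proof (rule P.continuous_map_ereal_Lipschitz)
    show "\<rho> X = ereal (real_of_ereal (\<rho> X))" if "X \<in> positions M" for X
      using assms(6) that unfolding finitely_valued_def \<rho>_def
      by (metis imageE real_of_ereal.simps(1))
    \<comment> \<open>The smallest positive payoff per unit of capital. It exists because
      \<open>U\<close> is finite, and nonempty since the payoff is not identically zero.\<close>
    define \<epsilon> where "\<epsilon> = Min (g ` U)"
    have "finite U" "U \<noteq> {}"
      using assms(2) S_nonzero S_nonneg by (auto simp: U_def order.order_iff_strict)
    then have \<epsilon>: "0 < \<epsilon>" "\<And>\<omega>. \<omega> \<in> U \<Longrightarrow> \<epsilon> \<le> g \<omega>"
      using gU by (auto simp: \<epsilon>_def)
    then show "0 < 1 / \<epsilon>" by simp
    show "real_of_ereal (\<rho> Y) \<le> real_of_ereal (\<rho> X) + 1 / \<epsilon> * sup_dist M X Y"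
      if X: "X \<in> positions M" and Y: "Y \<in> positions M" for X Y
    proof -
      \<comment> \<open>Capital \<open>D\<close> pays at least \<open>sup_dist M X Y\<close> at
        every point of \<open>U\<close>, enough to cover the difference between \<open>X\<close> and
        \<open>Y\<close> there.\<close>
      define D where "D = 1 / \<epsilon> * sup_dist M X Y"
      have acc: "measure M (F Y (m + D)) \<le> \<alpha>" if m: "measure M (F X m) \<le> \<alpha>" for m
      proof -
        have "F Y (m + D) \<inter> U \<subseteq> F X m"
        proof
          fix \<omega> assume \<omega>: "\<omega> \<in> F Y (m + D) \<inter> U"
          then have "\<omega> \<in> space M" by (simp add: F_def)
          from abs_diff_le_sup_dist[OF X Y this] have "X \<omega> - Y \<omega> \<le> sup_dist M X Y" by simp
          also have "\<dots> \<le> D * g \<omega>"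
            using mult_left_mono[OF \<epsilon>(2), of \<omega> "D"] \<epsilon>(1) \<omega> P.nonneg[of X Y]
            by (simp add: D_def)
          finally show "\<omega> \<in> F X m"
            using \<omega> by (simp add: F_def algebra_simps)
        qed
        then have "measure M (F Y (m + D) \<inter> U) \<le> measure M (F X m)"
          using F_sets[OF X] by (intro finite_measure_mono)
        with m have "measure M (F Y (m + D) \<inter> U) \<le> \<alpha>" by linarith
        \<comment> \<open>Nothing is known about \<open>Y\<close> on \<open>Z\<close>, but (b)
          leaves room under \<alpha> for all of \<open>Z\<close> to be added to this event.\<close>
        then have "measure M (F Y (m + D) \<inter> U) \<le> \<alpha> - measure M Z"
          using F_sets[OF Y] by (intro b) auto
        moreover have "measure M (F Y (m + D)) \<le> measure M (F Y (m + D) \<inter> U \<union> Z)"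
          using UZ F_sets[OF Y, of "m + D"] by (intro finite_measure_mono) (auto simp: F_def)
        moreover have "\<dots> \<le> measure M (F Y (m + D) \<inter> U) + measure M Z"
          using F_sets[OF Y, of "m + D"] by (intro measure_Un_le) auto
        ultimately show ?thesis by linarith
      qed
      obtain x y where x: "\<rho> X = ereal x" and y: "\<rho> Y = ereal y"
        using assms(6) X Y unfolding finitely_valued_def \<rho>_def by blast
      \<comment> \<open>By \<open>acc\<close>, every \<open>m\<close> admissible for
        \<open>X\<close> gives \<open>m + D\<close> admissible for \<open>Y\<close>, so
        \<open>y - D\<close> bounds the admissible amounts for \<open>X\<close> from below.\<close>
      have "ereal (y - D) \<le> \<rho> X"
        unfolding \<rho>[OF X]
      proof (rule Inf_greatest, clarify)
        fix m assume "measure M (F X m) \<le> \<alpha>"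
        then have "\<rho> Y \<le> ereal (m + D)"
          unfolding \<rho>[OF Y] using acc by (intro Inf_lower) blast
        then show "ereal (y - D) \<le> ereal m" by (simp add: y)
      qed
      then show ?thesis by (simp add: x y D_def)
    qed
  qed
  moreover have "measure M A \<le> \<alpha> - measure M Z"
    if cont: "continuous_map (positions_topology M) euclidean \<rho>"
      and A[measurable]: "A \<in> sets M" and AU: "A \<subseteq> U" and A\<alpha>: "measure M A \<le> \<alpha>" for A
  proof (rule ccontr)
    assume "\<not> measure M A \<le> \<alpha> - measure M Z"
    moreover have "measure M (A \<union> Z) = measure M A + measure M Z"
      using AU UZ by (intro finite_measure_Union) auto
    ultimately have AZ: "\<alpha> < measure M (A \<union> Z)" by linarith
    define X where "X = (\<lambda>t::real. \<lambda>\<omega>\<in>space M. - g \<omega> * indicator A \<omega> - t * indicator Z \<omega>)"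
    have X: "X t \<in> positions M" for t
      unfolding X_def by (intro restrict_in_positions assms(2)) measurable
    have "F (X 0) 0 \<subseteq> A"
      by (auto simp: F_def X_def split: split_indicator_asm)
    then have "measure M (F (X 0) 0) \<le> \<alpha>"
      using finite_measure_mono[OF _ A] A\<alpha> by (blast intro: order_trans)
    then have "\<rho> (X 0) \<le> ereal 0"
      unfolding \<rho>[OF X] by (intro Inf_lower) blast
    then have X0: "X 0 \<in> {Y \<in> positions M. \<rho> Y \<in> {..<1}}"
      using X by (simp add: order_le_less_trans)
    \<comment> \<open>The threshold 1 is the capital that offsets the loss on \<open>A\<close>;
      continuity keeps the risk below it on a whole ball around \<open>X 0\<close>.\<close>
    have "openin P.mtopology {Y \<in> positions M. \<rho> Y \<in> {..<1}}"
      using openin_continuous_map_preimage[OF cont, of "{..<1}"]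
      by (simp add: positions_topology_def)
    with X0 obtain r where r: "0 < r" "P.mball (X 0) r \<subseteq> {Y \<in> positions M. \<rho> Y \<in> {..<1}}"
      unfolding P.openin_mtopology by blast
    \<comment> \<open>Only a distance of at most \<open>t\<close> is shown below, so
      \<open>t\<close> is taken strictly smaller than the radius.\<close>
    define t where "t = r / 2"
    have t: "0 < t" "t < r" using r(1) by (simp_all add: t_def)
    have "sup_dist M (X 0) (X t) \<le> t"
      using t(1) by (intro sup_dist_le X not_empty) (auto simp: X_def split: split_indicator)
    then have "X t \<in> P.mball (X 0) r" using t X by simp
    then have "\<rho> (X t) < 1" using r(2) by auto
    then obtain m where m: "measure M (F (X t) m) \<le> \<alpha>" "m < 1"
      unfolding \<rho>[OF X] Inf_less_iff by (auto simp: one_ereal_def)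
    \<comment> \<open>With \<open>m < 1\<close> the hedged position equals
      \<open>(m - 1) * g\<close> on \<open>A\<close> and \<open>-t\<close> on \<open>Z\<close>, both
      negative, so the shortfall probability exceeds \<alpha>.\<close>
    have "A \<union> Z \<subseteq> F (X t) m"
    proof
      fix \<omega> assume "\<omega> \<in> A \<union> Z"
      then consider "\<omega> \<in> A" "\<omega> \<in> U" "\<omega> \<notin> Z" | "\<omega> \<in> Z" "\<omega> \<notin> A"
        using AU UZ by blast
      then show "\<omega> \<in> F (X t) m"
      proof cases
        case 1
        then have "m * g \<omega> < g \<omega>" using gU m(2) by simp
        then show ?thesis using 1 by (simp add: F_def X_def U_def)
      next
        case 2
        then show ?thesis using t(1) gZ by (simp add: F_def X_def Z_def)
      qed
    qed
    then have "measure M (A \<union> Z) \<le> measure M (F (X t) m)"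
      using F_sets[OF X] by (intro finite_measure_mono)
    with AZ m(1) show False by linarith
  qed
  ultimately show ?thesis
    unfolding \<rho>_def U_def Z_def by blast
qed

end
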